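(* Let $n$ be a positive integer and let $A=A_s+A_d\varepsilon$ be an $n\times n$ dual number matrix, with $A_s,A_d\in\mathbb{R}^{n\times n}$. Then the powers $A^k$ ($k\in\mathbb{N}$) converge to the zero matrix $O$ as $k\to\infty$ if and only if $\rho(A_s)<1$, where $\rho(A_s)$ denotes the spectral radius of the real matrix $A_s$ (the maximum modulus of its complex eigenvalues).
   Context: The symbol $\varepsilon$ is the infinitesimal unit: it commutes with real numbers and satisfies $\varepsilon\neq 0$, $\varepsilon^2=0$. A dual number is $a=a_s+a_d\varepsilon$ with standard part $a_s\in\mathbb{R}$ and dual part $a_d\in\mathbb{R}$; the set of dual numbers is $\mathbb{D}=\mathbb{R}[\varepsilon]/(\varepsilon^2)$, with $a+b=(a_s+b_s)+(a_d+b_d)\varepsilon$ and $ab=a_sb_s+(a_sb_d+a_db_s)\varepsilon$. A dual number matrix $A=A_s+A_d\varepsilon\in\mathbb{D}^{n\times n}$ has standard part $A_s$ and dual part $A_d$, both real matrices; products are the usual matrix products over the commutative ring $\mathbb{D}$. A sequence of dual numbers converges to $0$ if both its standard parts and its dual parts converge to $0$ in $\mathbb{R}$; a sequence of dual number matrices converges to $O$ if every entry converges to $0$ (equivalently, both the standard parts and the dual parts converge to the zero matrix). *)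

theory Defs
  imports "Jordan_Normal_Form.Spectral_Radius"
begin

text \<open>Dual numbers \<open>a\<^sub>s + a\<^sub>d \<epsilon>\<close>, where \<open>\<epsilon>\<close> is nonzero and squares to zero.\<close>

datatype dual_number = Dual (std_part: real) (dual_part: real)

instantiation dual_number :: comm_ring_1
begin

definition zero_dual_number :: dual_number where
  "0 = Dual 0 0"

definition one_dual_number :: dual_number where
  "1 = Dual 1 0"

definition plus_dual_number :: "dual_number \<Rightarrow> dual_number \<Rightarrow> dual_number" where
  "a + b = Dual (std_part a + std_part b) (dual_part a + dual_part b)"

definition uminus_dual_number :: "dual_number \<Rightarrow> dual_number" where
  "- a = Dual (- std_part a) (- dual_part a)"

definition minus_dual_number :: "dual_number \<Rightarrow> dual_number \<Rightarrow> dual_number" where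
  "a - b = Dual (std_part a - std_part b) (dual_part a - dual_part b)"

definition times_dual_number :: "dual_number \<Rightarrow> dual_number \<Rightarrow> dual_number" where
  "a * b = Dual (std_part a * std_part b) (std_part a * dual_part b + dual_part a * std_part b)"

instance
  by standard
    (auto simp: zero_dual_number_def one_dual_number_def plus_dual_number_def
      uminus_dual_number_def minus_dual_number_def times_dual_number_def algebra_simps)

end

definition dual_of_real :: "real \<Rightarrow> dual_number" where
  "dual_of_real x = Dual x 0"

definition dual_eps :: dual_number where
  "dual_eps = Dual 0 1"

lemma dual_eps_nonzero: "dual_eps \<noteq> 0"
  by (simp add: dual_eps_def zero_dual_number_def)

lemma dual_eps_square: "dual_eps ^ 2 = 0"
  by (simp add: power2_eq_square dual_eps_def times_dual_number_def zero_dual_number_def)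

lemma dual_number_decomp:
  "a = dual_of_real (std_part a) + dual_of_real (dual_part a) * dual_eps"
  by (simp add: dual_of_real_def dual_eps_def plus_dual_number_def times_dual_number_def)

abbreviation std_mat :: "dual_number mat \<Rightarrow> real mat" where
  "std_mat A \<equiv> map_mat std_part A"

abbreviation dual_mat :: "dual_number mat \<Rightarrow> real mat" where
  "dual_mat A \<equiv> map_mat dual_part A"

lemma dual_number_mat_decomp:
  "A = map_mat dual_of_real (std_mat A) + dual_eps \<cdot>\<^sub>m map_mat dual_of_real (dual_mat A)"
  by (rule eq_matI) (simp_all add: dual_of_real_def dual_eps_def plus_dual_number_def times_dual_number_def)

definition dual_tendsto_zero :: "(nat \<Rightarrow> dual_number) \<Rightarrow> bool" where
  "dual_tendsto_zero x \<longleftrightarrow>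
     (\<lambda>k. std_part (x k)) \<longlonglongrightarrow> 0 \<and> (\<lambda>k. dual_part (x k)) \<longlonglongrightarrow> 0"

text \<open>Entrywise convergence to the zero matrix; \<open>n\<close> is the common dimension of the
  matrices \<open>X k\<close>, which their type does not record.\<close>

definition dual_mat_tendsto_zero :: "nat \<Rightarrow> (nat \<Rightarrow> dual_number mat) \<Rightarrow> bool" where
  "dual_mat_tendsto_zero n X \<longleftrightarrow>
     (\<forall>i<n. \<forall>j<n. dual_tendsto_zero (\<lambda>k. X k $$ (i, j)))"

text \<open>\<open>spectral_radius\<close> is defined for complex matrices, so a real matrix is first viewed
  as a complex one and all its complex eigenvalues are taken into account.\<close>

definition real_spectral_radius :: "real mat \<Rightarrow> real" where
  "real_spectral_radius B = spectral_radius (map_mat complex_of_real B)"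

end

(* The dual number a + b \<epsilon> corresponds to the 2x2 matrix [[a, b], [0, a]], so an n x n dual
   matrix A with parts S, D corresponds multiplicatively to the 2n x 2n block matrix
   [[S, D], [0, S]].  Its characteristic polynomial is the square of that of S, hence both have the
   same spectral radius, and the claim reduces to the classical criterion for complex matrices.
   In the latter, if t lies strictly between the spectral radius and 1, the powers of (1/t) M
   are bounded, so those of M are O(t^k); conversely an eigenvector for an eigenvalue z satisfies
   M^k v = z^k v, which forces |z| < 1. *)
theory Submission
  imports Defs
begin

lemma pow_smult_mat:
  fixes A :: "'a::comm_ring_1 mat"
  assumes A: "A \<in> carrier_mat n n"
  shows "(c \<cdot>\<^sub>m A) ^\<^sub>m k = c ^ k \<cdot>\<^sub>m (A ^\<^sub>m k)"
proof (induction k)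
  case 0
  then show ?case by (intro eq_matI) auto
next
  case (Suc k)
  have Ak: "A ^\<^sub>m k \<in> carrier_mat n n" using A by simp
  have "(c \<cdot>\<^sub>m A) ^\<^sub>m Suc k = c ^ k \<cdot>\<^sub>m (A ^\<^sub>m k) * (c \<cdot>\<^sub>m A)"
    using Suc by simp
  also have "\<dots> = c ^ k \<cdot>\<^sub>m (c \<cdot>\<^sub>m (A ^\<^sub>m k * A))"
    using A by (simp add: mult_smult_assoc_mat[OF Ak, of "c \<cdot>\<^sub>m A" n] mult_smult_distrib[OF Ak A])
  also have "\<dots> = c ^ Suc k \<cdot>\<^sub>m (A ^\<^sub>m Suc k)"
    by (intro eq_matI) (auto simp: mult_ac)
  finally show ?case .
qed

text \<open>Scaling by a nonzero \<open>c\<close> keeps the eigenvectors and multiplies the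
  eigenvalues by \<open>c\<close>. This direction lets a bound on the eigenvalues of
  \<open>A\<close> pass to those of a multiple of \<open>A\<close>.\<close>

lemma eigenvalue_smult_matD:
  fixes A :: "'a::field mat"
  assumes A: "A \<in> carrier_mat n n" and c: "c \<noteq> 0" and ev: "eigenvalue (c \<cdot>\<^sub>m A) z"
  shows "eigenvalue A (z / c)"
proof -
  obtain v where v: "v \<in> carrier_vec n" "v \<noteq> 0\<^sub>v n" and eq: "(c \<cdot>\<^sub>m A) *\<^sub>v v = z \<cdot>\<^sub>v v"
    using ev A unfolding eigenvalue_def eigenvector_def by auto
  have "A *\<^sub>v v = (z / c) \<cdot>\<^sub>v v"
  proof (rule eq_vecI)
    fix i assume i: "i < dim_vec ((z / c) \<cdot>\<^sub>v v)"
    then have "i < n" using v by simp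
    then have "c * (row A i \<bullet> v) = z * v $ i"
      using arg_cong[OF eq, of "\<lambda>w. w $ i"] A v by simp
    then show "(A *\<^sub>v v) $ i = ((z / c) \<cdot>\<^sub>v v) $ i"
      using \<open>i < n\<close> A v c by (simp add: field_simps)
  qed (use A v in simp)
  then show ?thesis
    using v A unfolding eigenvalue_def eigenvector_def by auto
qed

lemma complex_mat_pow_tendsto_zero:
  fixes A :: "complex mat"
  assumes A: "A \<in> carrier_mat n n" and n: "n > 0" and sr: "spectral_radius A < 1"
    and ij: "i < n" "j < n"
  shows "(\<lambda>k. (A ^\<^sub>m k) $$ (i, j)) \<longlonglongrightarrow> 0"
proof -
  obtain t where t: "spectral_radius A < t" "t < 1"
    using dense[OF sr] by blast
  \<comment> \<open>Only \<open>t > 0\<close> makes the rescaling by \<open>1 / t\<close>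
    legitimate; it follows since \<open>t\<close> exceeds a modulus.\<close>
  have "0 \<le> spectral_radius A"
    using spectral_radius_mem_max(1)[OF A n] by auto
  then have t0: "t > 0" using t by simp
  define B where "B = complex_of_real (1 / t) \<cdot>\<^sub>m A"
  have B: "B \<in> carrier_mat n n" using A by (simp add: B_def)
  \<comment> \<open>An eigenvalue of maximal modulus: bounding this single \<open>z\<close> bounds
    the spectral radius of \<open>B\<close>.\<close>
  obtain z where z: "eigenvalue B z" and nz: "spectral_radius B = norm z"
    using spectral_radius_mem_max(1)[OF B n] unfolding spectrum_def by auto
  have "eigenvalue A (z / complex_of_real (1 / t))"
    using eigenvalue_smult_matD[OF A _ z[unfolded B_def]] t0 by simp
  then have "norm (z / complex_of_real (1 / t)) \<le> spectral_radius A"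
    by (intro spectral_radius_mem_max(2)[OF A n]) (auto simp: spectrum_def)
  then have "norm z * t \<le> spectral_radius A"
    using t0 by (simp add: norm_mult)
  then have "norm z * t < 1 * t"
    using t by linarith
  then have "norm z < 1"
    using t0 by (simp only: mult_less_cancel_right_pos)
  then have "spectral_radius B < 1" using nz by simp
  \<comment> \<open>Only boundedness of the powers of \<open>B\<close> is drawn from its spectral
    radius; the decay reappears as the factor \<open>t ^ k\<close> once the scaling is
    undone.\<close>
  then obtain c where "\<And>k. norm_bound (B ^\<^sub>m k) c"
    using spectral_radius_jnf_norm_bound_less_1_upper_triangular[OF B] by blast
  then have c: "norm ((B ^\<^sub>m k) $$ (i, j)) \<le> c" for k
    using ij B unfolding norm_bound_def by (simp only: pow_mat_dim_square)
  have bound: "norm ((A ^\<^sub>m k) $$ (i, j)) \<le> c * t ^ k" for k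
  proof -
    have "(B ^\<^sub>m k) $$ (i, j) = complex_of_real (1 / t) ^ k * (A ^\<^sub>m k) $$ (i, j)"
      using ij A by (simp add: B_def pow_smult_mat[OF A])
    then have "norm ((B ^\<^sub>m k) $$ (i, j)) = norm ((A ^\<^sub>m k) $$ (i, j)) / t ^ k"
      using t0 by (simp add: norm_mult norm_power norm_divide power_divide)
    then show ?thesis using c[of k] t0 by (simp add: pos_divide_le_eq)
  qed
  have "(\<lambda>k. c * t ^ k) \<longlonglongrightarrow> 0"
    using tendsto_mult_right_zero[OF LIMSEQ_realpow_zero, of t c] t t0 by simp
  then show ?thesis
    by (rule tendsto_0_le[where K = 1]) (auto intro!: always_eventually order_trans[OF bound])
qed

lemma spectral_radius_less_1_if_pow_tendsto_zero:
  fixes A :: "complex mat"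
  assumes A: "A \<in> carrier_mat n n" and n: "n > 0"
    and lim: "\<And>i j. i < n \<Longrightarrow> j < n \<Longrightarrow> (\<lambda>k. (A ^\<^sub>m k) $$ (i, j)) \<longlonglongrightarrow> 0"
  shows "spectral_radius A < 1"
proof -
  obtain z v where nz: "spectral_radius A = norm z" and ev: "eigenvector A v z"
    using spectral_radius_mem_max(1)[OF A n] unfolding spectrum_def eigenvalue_def by auto
  have v: "v \<in> carrier_vec n" "v \<noteq> 0\<^sub>v n"
    using ev A unfolding eigenvector_def by auto
  \<comment> \<open>A nonzero coordinate of the eigenvector, by which the vector identity can be
    divided to isolate \<open>z ^ k\<close>.\<close>
  obtain i where i: "i < n" "v $ i \<noteq> 0"
    using v by (metis carrier_vecD eq_vecI index_zero_vec)
  have "(A ^\<^sub>m k *\<^sub>v v) $ i = (\<Sum>j<n. (A ^\<^sub>m k) $$ (i, j) * v $ j)" for k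
    using i A v by (simp add: scalar_prod_def lessThan_atLeast0)
  then have pow: "z ^ k * v $ i = (\<Sum>j<n. (A ^\<^sub>m k) $$ (i, j) * v $ j)" for k
    using arg_cong[OF eigenvector_pow[OF A ev, of k], of "\<lambda>w. w $ i"] i v by simp
  \<comment> \<open>The sum has a fixed finite number of terms, so entrywise convergence
    suffices.\<close>
  have "(\<lambda>k. z ^ k * v $ i) \<longlonglongrightarrow> 0"
    unfolding pow by (intro tendsto_null_sum tendsto_mult_left_zero lim) (use i in auto)
  then have "(\<lambda>k. norm (z ^ k * v $ i) / norm (v $ i)) \<longlonglongrightarrow> 0"
    by (intro tendsto_divide_zero tendsto_norm_zero)
  then have to0: "(\<lambda>k. norm z ^ k) \<longlonglongrightarrow> 0"
    using i by (simp add: norm_mult norm_power)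
  have "norm z < 1"
  proof (rule ccontr)
    assume "\<not> norm z < 1"
    then have "\<forall>k. 1 \<le> norm z ^ k" by (simp add: one_le_power)
    then have "(1::real) \<le> 0"
      using to0 by (intro LIMSEQ_le_const[OF to0]) auto
    then show False by simp
  qed
  then show ?thesis using nz by simp
qed

lemma std_part_arith [simp]:
  "std_part 0 = 0" "std_part 1 = 1" "std_part (a + b) = std_part a + std_part b"
  "std_part (a * b) = std_part a * std_part b"
  by (simp_all add: zero_dual_number_def one_dual_number_def plus_dual_number_def
      times_dual_number_def)

lemma dual_part_arith [simp]:
  "dual_part 0 = 0" "dual_part 1 = 0" "dual_part (a + b) = dual_part a + dual_part b"
  "dual_part (a * b) = std_part a * dual_part b + dual_part a * std_part b"
  by (simp_all add: zero_dual_number_def one_dual_number_def plus_dual_number_def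
      times_dual_number_def)

lemma std_part_sum: "std_part (sum f I) = (\<Sum>i\<in>I. std_part (f i))"
  by (induction I rule: infinite_finite_induct) simp_all

lemma dual_part_sum: "dual_part (sum f I) = (\<Sum>i\<in>I. dual_part (f i))"
  by (induction I rule: infinite_finite_induct) simp_all

text \<open>The regular representation of the dual numbers in the basis
  \<open>\<epsilon>, 1\<close>, with standard and dual parts collected into \<open>n\<close> by
  \<open>n\<close> blocks. The entries are complex so that \<open>spectral_radius\<close> applies
  directly.\<close>

definition dual_block :: "dual_number mat \<Rightarrow> complex mat" where
  "dual_block A =
     four_block_mat (map_mat complex_of_real (std_mat A)) (map_mat complex_of_real (dual_mat A))
       (0\<^sub>m (dim_row A) (dim_col A)) (map_mat complex_of_real (std_mat A))"

lemma dual_block_carrier [simp]: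
  "A \<in> carrier_mat n m \<Longrightarrow> dual_block A \<in> carrier_mat (n + n) (m + m)"
  by (simp add: dual_block_def)

lemma dual_block_one: "dual_block (1\<^sub>m n) = 1\<^sub>m (n + n)"
proof -
  have "map_mat complex_of_real (std_mat (1\<^sub>m n)) = 1\<^sub>m n"
    and "map_mat complex_of_real (dual_mat (1\<^sub>m n)) = 0\<^sub>m n n"
    by (intro eq_matI; simp)+
  then show ?thesis by (simp add: dual_block_def)
qed

text \<open>The upper right block of the product is the Leibniz-type expression that gives the dual
  part of a product of dual numbers.\<close>

lemma dual_block_mult:
  assumes A: "A \<in> carrier_mat n m" and B: "B \<in> carrier_mat m l"
  shows "dual_block (A * B) = dual_block A * dual_block B"
proof -
  let ?s = "\<lambda>M. map_mat complex_of_real (std_mat M)"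
  let ?d = "\<lambda>M. map_mat complex_of_real (dual_mat M)"
  have c: "?s A \<in> carrier_mat n m" "?d A \<in> carrier_mat n m"
    "?s B \<in> carrier_mat m l" "?d B \<in> carrier_mat m l"
    using A B by auto
  have s: "?s (A * B) = ?s A * ?s B"
    using A B by (intro eq_matI) (auto simp: scalar_prod_def std_part_sum)
  have d: "?d (A * B) = ?s A * ?d B + ?d A * ?s B"
    using A B by (intro eq_matI) (auto simp: scalar_prod_def dual_part_sum sum.distrib)
  have "dual_block A * dual_block B =
    four_block_mat (?s A * ?s B + ?d A * 0\<^sub>m m l) (?s A * ?d B + ?d A * ?s B)
      (0\<^sub>m n m * ?s B + ?s A * 0\<^sub>m m l) (0\<^sub>m n m * ?d B + ?s A * ?s B)"
    using A B c unfolding dual_block_def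
    by (simp add: mult_four_block_mat[of _ n m _ m _ n _ _ l _ l])
  then show ?thesis
    using A B c unfolding dual_block_def s d by simp
qed

lemma dual_block_pow:
  assumes A: "A \<in> carrier_mat n n"
  shows "dual_block (A ^\<^sub>m k) = dual_block A ^\<^sub>m k"
proof (induction k)
  case 0
  \<comment> \<open>The zeroth power is the identity matrix whose size is read off from
    \<open>dim_row\<close>.\<close>
  have "dim_row (dual_block A) = n + n" using A by (simp add: dual_block_def)
  then show ?case using A by (simp add: dual_block_one)
next
  case (Suc k)
  then show ?case using dual_block_mult[of "A ^\<^sub>m k" n n A n] A by simp
qed

lemma spectrum_dual_block:
  assumes A: "A \<in> carrier_mat n n"
  shows "spectrum (dual_block A) = spectrum (map_mat complex_of_real (std_mat A))"
proof -
  let ?S = "map_mat complex_of_real (std_mat A)"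
  have S: "?S \<in> carrier_mat n n" using A by simp
  \<comment> \<open>Over the complex numbers the polynomial splits into linear factors, as
    \<open>char_poly_0_block\<close> requires of the diagonal blocks.\<close>
  have "\<exists>es. char_poly ?S = (\<Prod>a\<leftarrow>es. [:- a, 1:])"
    using char_poly_factorized[OF S] by blast
  then have "char_poly (dual_block A) = char_poly ?S * char_poly ?S"
    using A by (intro char_poly_0_block[where n = n and m = n]) (auto simp: dual_block_def)
  \<comment> \<open>Spectra are root sets, and squaring a polynomial leaves its roots
    unchanged.\<close>
  then show ?thesis
    using A by (simp add: spectrum_root_char_poly[OF S]
        spectrum_root_char_poly[OF dual_block_carrier[OF A]])
qed

lemma dual_mat_tendsto_zero_iff_dual_block:
  assumes X: "\<And>k. X k \<in> carrier_mat n n"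
  shows "dual_mat_tendsto_zero n X \<longleftrightarrow>
    (\<forall>i<n + n. \<forall>j<n + n. (\<lambda>k. dual_block (X k) $$ (i, j)) \<longlonglongrightarrow> 0)"
    (is "?L \<longleftrightarrow> ?R")
proof
  have entry: "dual_block (X k) $$ (i, j) =
      (if i < n then
         if j < n then complex_of_real (std_part (X k $$ (i, j)))
         else complex_of_real (dual_part (X k $$ (i, j - n)))
       else if j < n then 0 else complex_of_real (std_part (X k $$ (i - n, j - n))))"
    if "i < n + n" "j < n + n" for i j k
    using X[of k] that by (auto simp: dual_block_def)
  have of_real_lim: "(\<lambda>k. complex_of_real (f k)) \<longlonglongrightarrow> 0 \<longleftrightarrow> f \<longlonglongrightarrow> 0" for f
    using tendsto_of_real_iff[of f 0 sequentially, where 'a = complex] by simp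
  show ?R if ?L
  proof (intro allI impI)
    fix i j assume ij: "i < n + n" "j < n + n"
    have lim: "(\<lambda>k. std_part (X k $$ (i', j'))) \<longlonglongrightarrow> 0" "(\<lambda>k. dual_part (X k $$ (i', j'))) \<longlonglongrightarrow> 0"
      if "i' < n" "j' < n" for i' j'
      using \<open>?L\<close> that unfolding dual_mat_tendsto_zero_def dual_tendsto_zero_def by blast+
    show "(\<lambda>k. dual_block (X k) $$ (i, j)) \<longlonglongrightarrow> 0"
      unfolding entry[OF ij] using ij lim
      by (cases "i < n"; cases "j < n") (simp_all add: of_real_lim)
  qed
  show ?L if ?R
    unfolding dual_mat_tendsto_zero_def dual_tendsto_zero_def
  proof (intro allI impI conjI)
    fix i j assume ij: "i < n" "j < n"
    show "(\<lambda>k. std_part (X k $$ (i, j))) \<longlonglongrightarrow> 0"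
      using \<open>?R\<close>[rule_format, of i j] ij by (simp add: entry of_real_lim)
    show "(\<lambda>k. dual_part (X k $$ (i, j))) \<longlonglongrightarrow> 0"
      \<comment> \<open>The column offset \<open>n\<close> selects the upper right block, where the
        dual parts sit.\<close>
      using \<open>?R\<close>[rule_format, of i "n + j"] ij by (simp add: entry of_real_lim)
  qed
qed

theorem theorem2:
  fixes A :: "dual_number mat" and n :: nat
  assumes "n > 0"
    and "A \<in> carrier_mat n n"
  shows "dual_mat_tendsto_zero n (\<lambda>k. A ^\<^sub>m k) \<longleftrightarrow> real_spectral_radius (std_mat A) < 1"
proof -
  have B: "dual_block A \<in> carrier_mat (n + n) (n + n)" and n: "n + n > 0"
    using assms by simp_all
  have "dual_mat_tendsto_zero n (\<lambda>k. A ^\<^sub>m k) \<longleftrightarrow>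
      (\<forall>i<n + n. \<forall>j<n + n. (\<lambda>k. (dual_block A ^\<^sub>m k) $$ (i, j)) \<longlonglongrightarrow> 0)"
    using assms(2) by (simp add: dual_mat_tendsto_zero_iff_dual_block dual_block_pow)
  \<comment> \<open>The classical criterion, applied in dimension \<open>n + n\<close>.\<close>
  also have "\<dots> \<longleftrightarrow> spectral_radius (dual_block A) < 1"
    using complex_mat_pow_tendsto_zero[OF B n] spectral_radius_less_1_if_pow_tendsto_zero[OF B n]
    by blast
  also have "spectral_radius (dual_block A) = real_spectral_radius (std_mat A)"
    using assms(2) by (simp add: real_spectral_radius_def spectral_radius_def spectrum_dual_block)
  finally show ?thesis .
qed

end
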